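(* For every positive integer $n$, the set of sizes of the orbits of ${\rm Aut}(\Lambda_n)$ acting on $E(\Lambda_n)$ is contained in $\{n,2n\}$, and it equals $\{n,2n\}$ if and only if $n\ge 5$.
   Context: A Lucas string of length $n$ is a binary string $u_1\cdots u_n$ with no two consecutive 1s and not both $u_1=1$ and $u_n=1$. The Lucas cube $\Lambda_n$ is the subgraph of the $n$-cube $Q_n$ (binary strings of length $n$, adjacent iff they differ in exactly one position) induced by the Lucas strings of length $n$. ${\rm Aut}(\Lambda_n)$ acts on edges by $\{u,v\}\mapsto\{g(u),g(v)\}$. *)

theory Defs
  imports "HOL-Algebra.Algebra"
begin

text \<open>A simple graph is a pair of a vertex set and a set of two-element edges.\<close>

type_synonym 'a graph = "'a set \<times> 'a set set"

abbreviation verts :: "'a graph \<Rightarrow> 'a set"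
  where "verts \<equiv> fst"

abbreviation edges :: "'a graph \<Rightarrow> 'a set set"
  where "edges \<equiv> snd"

definition induced_subgraph :: "'a graph \<Rightarrow> 'a set \<Rightarrow> 'a graph"
  where "induced_subgraph G W = (verts G \<inter> W, {e \<in> edges G. e \<subseteq> W})"

definition graph_automorphisms :: "'a graph \<Rightarrow> ('a \<Rightarrow> 'a) set"
  where "graph_automorphisms G =
    {g \<in> Bij (verts G). \<forall>u\<in>verts G. \<forall>v\<in>verts G.
       {u, v} \<in> edges G \<longleftrightarrow> {g u, g v} \<in> edges G}"

definition Aut :: "'a graph \<Rightarrow> ('a \<Rightarrow> 'a) monoid"
  where "Aut G = BijGroup (verts G) \<lparr>carrier := graph_automorphisms G\<rparr>"

text \<open>The restriction to \<^term>\<open>edges G\<close> makes each value an element of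
  \<^term>\<open>BijGroup (edges G)\<close>, as the locale \<^locale>\<open>group_action\<close> requires.\<close>

definition edge_action :: "'a graph \<Rightarrow> ('a \<Rightarrow> 'a) \<Rightarrow> 'a set \<Rightarrow> 'a set"
  where "edge_action G g = (\<lambda>e\<in>edges G. g ` e)"

text \<open>Binary strings are lists of truth values, with \<^term>\<open>True\<close> for the digit 1;
  the position written \<open>i\<close> in \<open>u\<^sub>1 \<dots> u\<^sub>n\<close> has list index \<open>i - 1\<close>.\<close>

definition hypercube :: "nat \<Rightarrow> bool list graph"
  where "hypercube n =
    ({u. length u = n},
     {{u, v} | u v. length u = n \<and> length v = n \<and> card {i. i < n \<and> u ! i \<noteq> v ! i} = 1})"

text \<open>For length 1 the first and the last digit coincide, so the string 1 is not Lucas.\<close>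

definition lucas_string :: "bool list \<Rightarrow> bool"
  where "lucas_string u \<longleftrightarrow>
    (\<forall>i. Suc i < length u \<longrightarrow> \<not> (u ! i \<and> u ! Suc i)) \<and>
    (u \<noteq> [] \<longrightarrow> \<not> (hd u \<and> last u))"

definition lucas_cube :: "nat \<Rightarrow> bool list graph"
  where "lucas_cube n = induced_subgraph (hypercube n) {u. length u = n \<and> lucas_string u}"

lemma subgroup_graph_automorphisms:
  "subgroup (graph_automorphisms G) (BijGroup (verts G))"
proof (rule subgroup.intro)
  show "graph_automorphisms G \<subseteq> carrier (BijGroup (verts G))"
    by (auto simp: graph_automorphisms_def BijGroup_def)
next
  fix x y
  assume "x \<in> graph_automorphisms G" "y \<in> graph_automorphisms G"
  moreover from this have "x \<in> Bij (verts G)" "y \<in> Bij (verts G)"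
    by (auto simp: graph_automorphisms_def)
  moreover from this have "\<And>u. u \<in> verts G \<Longrightarrow> y u \<in> verts G"
    by (blast dest: Bij_imp_funcset)
  ultimately show "x \<otimes>\<^bsub>BijGroup (verts G)\<^esub> y \<in> graph_automorphisms G"
    by (auto simp: graph_automorphisms_def BijGroup_def compose_Bij compose_eq)
next
  show "\<one>\<^bsub>BijGroup (verts G)\<^esub> \<in> graph_automorphisms G"
    by (simp add: graph_automorphisms_def BijGroup_def id_Bij)
next
  fix x
  assume x: "x \<in> graph_automorphisms G"
  then have b: "x \<in> Bij (verts G)"
    by (simp add: graph_automorphisms_def)
  then have "x ` verts G = verts G"
    by (simp add: Bij_def bij_betw_def)
  then have r: "x (inv_into (verts G) x u) = u" if "u \<in> verts G" for u
    using that by (simp add: f_inv_into_f)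
  from x b show "inv\<^bsub>BijGroup (verts G)\<^esub> x \<in> graph_automorphisms G"
    using Bij_inv_into_mem[OF b]
    by (simp add: inv_BijGroup graph_automorphisms_def restrict_inv_into_Bij r)
qed

theorem group_Aut: "group (Aut G)"
  unfolding Aut_def
  by (rule subgroup.subgroup_is_group[OF subgroup_graph_automorphisms group_BijGroup])

definition simple_graph :: "'a graph \<Rightarrow> bool"
  where "simple_graph G \<longleftrightarrow> (\<forall>e\<in>edges G. e \<subseteq> verts G \<and> card e = 2)"

lemma edge_image:
  assumes "simple_graph G" "g \<in> graph_automorphisms G" "e \<in> edges G"
  shows "g ` e \<in> edges G"
proof -
  from assms(1,3) obtain u v where "e = {u, v}" "u \<in> verts G" "v \<in> verts G"
    by (metis card_2_iff insert_subset simple_graph_def)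
  with assms(2,3) show ?thesis
    by (auto simp: graph_automorphisms_def)
qed

theorem group_action_edges:
  assumes s: "simple_graph G"
  shows "group_action (Aut G) (edges G) (edge_action G)"
proof -
  interpret A: group "Aut G" by (rule group_Aut)
  have car: "carrier (Aut G) = graph_automorphisms G"
    by (simp add: Aut_def)
  have comp: "(x \<otimes>\<^bsub>Aut G\<^esub> y) ` e = x ` (y ` e)"
    if "x \<in> graph_automorphisms G" "y \<in> graph_automorphisms G" "e \<in> edges G" for x y e
  proof -
    have "x \<in> Bij (verts G)" "y \<in> Bij (verts G)" "e \<subseteq> verts G"
      using that s by (auto simp: graph_automorphisms_def simple_graph_def)
    then show ?thesis
      by (auto simp: Aut_def BijGroup_def compose_def image_image intro!: image_cong)
  qed
  have one: "\<one>\<^bsub>Aut G\<^esub> ` e = e" if "e \<in> edges G" for e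
  proof -
    have "e \<subseteq> verts G" using that s by (auto simp: simple_graph_def)
    then show ?thesis by (auto simp: Aut_def BijGroup_def image_iff subset_iff)
  qed
  have bij: "edge_action G g \<in> Bij (edges G)" if g: "g \<in> graph_automorphisms G" for g
  proof -
    let ?h = "inv\<^bsub>Aut G\<^esub> g"
    have h: "?h \<in> graph_automorphisms G"
      using A.inv_closed g by (simp add: car)
    have "?h ` (g ` e) = e" "g ` (?h ` e) = e" if "e \<in> edges G" for e
      using comp[OF h g that] comp[OF g h that] one[OF that] g
      by (simp_all add: car)
    then have "bij_betw ((`) g) (edges G) (edges G)"
      by (intro bij_betw_byWitness[where f' = "(`) ?h"])
         (auto intro: edge_image[OF s g] edge_image[OF s h])
    then have "bij_betw (edge_action G g) (edges G) (edges G)"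
      by (rule bij_betw_cong[THEN iffD1, rotated]) (simp add: edge_action_def)
    then show ?thesis
      by (simp add: Bij_def edge_action_def)
  qed
  have "edge_action G \<in> hom (Aut G) (BijGroup (edges G))"
  proof (rule homI)
    fix x assume "x \<in> carrier (Aut G)"
    then show "edge_action G x \<in> carrier (BijGroup (edges G))"
      using bij by (simp add: car BijGroup_def)
  next
    fix x y assume "x \<in> carrier (Aut G)" "y \<in> carrier (Aut G)"
    then have xy: "x \<in> graph_automorphisms G" "y \<in> graph_automorphisms G"
      by (simp_all add: car)
    have "edge_action G (x \<otimes>\<^bsub>Aut G\<^esub> y) = compose (edges G) (edge_action G x) (edge_action G y)"
      by (rule ext) (simp add: edge_action_def compose_def comp[OF xy] edge_image[OF s xy(2)])
    then show "edge_action G (x \<otimes>\<^bsub>Aut G\<^esub> y) = edge_action G x \<otimes>\<^bsub>BijGroup (edges G)\<^esub> edge_action G y"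
      using bij xy by (simp add: BijGroup_def)
  qed
  then show ?thesis
    by (simp add: group_action_def group_hom_def group_hom_axioms_def group_BijGroup
        A.group_axioms)
qed

lemma simple_graph_lucas_cube: "simple_graph (lucas_cube n)"
proof -
  have "u \<noteq> v" if "card {i. i < n \<and> u ! i \<noteq> v ! i} = 1" for u v :: "bool list"
    using that by auto
  then show ?thesis
    by (auto simp: simple_graph_def lucas_cube_def induced_subgraph_def hypercube_def card_2_iff)
qed

end

theory Submission
  imports Defs
begin

text \<open>The vertices of the Lucas cube are the independent sets of the cycle on
  \<open>{0, \<dots>, n - 1}\<close>. The all-zero string is the only vertex of degree \<open>n\<close>, so an automorphism
  fixes it and permutes the strings of weight 1; two of these have a second common neighbour
  iff their positions are not adjacent on the cycle, so the permutation is an automorphism of the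
  cycle, i.e. a rotation or a reflection. By induction on the weight it determines the
  automorphism everywhere, so the group acts as the dihedral group. An edge is a pair \<open>(S, x)\<close>
  of a lower endpoint and the added position. The rotations move \<open>x\<close> freely, so rotations
  yield \<open>n\<close> edges and so do reflections, and these two sets are equal or disjoint. For
  \<open>n \<ge> 5\<close> the edges \<open>({}, 0)\<close> and \<open>({2}, 0)\<close> have orbits of size \<open>n\<close> and \<open>2n\<close>; for \<open>n \<le> 4\<close> the
  reflection \<open>i \<mapsto> 2x - i\<close> fixes every edge \<open>(S, x)\<close>.\<close>

section \<open>Binary strings as sets of positions on a cycle\<close>

definition cyc_indep :: "nat \<Rightarrow> int set \<Rightarrow> bool"
  where "cyc_indep n S \<longleftrightarrow> S \<subseteq> {0..<int n} \<and> (\<forall>i\<in>S. (i + 1) mod int n \<notin> S)"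

text \<open>Positions are integers rather than naturals so that reflections can subtract modulo
  \<open>n\<close>.\<close>

definition bits :: "nat \<Rightarrow> int set \<Rightarrow> bool list"
  where "bits n S = map (\<lambda>i. int i \<in> S) [0..<n]"

definition supp :: "bool list \<Rightarrow> int set"
  where "supp u = {i. 0 \<le> i \<and> i < int (length u) \<and> u ! nat i}"

definition adj :: "'a set \<Rightarrow> 'a set \<Rightarrow> bool"
  where "adj S T \<longleftrightarrow> (\<exists>x. x \<notin> S \<and> T = insert x S) \<or> (\<exists>x. x \<notin> T \<and> S = insert x T)"

text \<open>For \<open>s = 1\<close> these are the rotations and for \<open>s = -1\<close> the reflections of the cycle.\<close>

definition dih :: "nat \<Rightarrow> int \<Rightarrow> int \<Rightarrow> int \<Rightarrow> int"
  where "dih n k s i = (k + s * i) mod int n"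

definition bits_edge :: "nat \<Rightarrow> int set \<Rightarrow> int \<Rightarrow> bool list set"
  where "bits_edge n S x = {bits n S, bits n (insert x S)}"

lemma length_bits [simp]: "length (bits n S) = n"
  by (simp add: bits_def)

lemma nth_bits [simp]: "i < n \<Longrightarrow> bits n S ! i \<longleftrightarrow> int i \<in> S"
  by (simp add: bits_def)

lemma supp_bits: "S \<subseteq> {0..<int n} \<Longrightarrow> supp (bits n S) = S"
  using subsetD[of S "{0..<int n}"] by (fastforce simp: supp_def nat_less_iff)

lemma bits_supp: "length u = n \<Longrightarrow> bits n (supp u) = u"
  by (auto intro!: nth_equalityI simp: supp_def)

lemma bits_eq_iff:
  "S \<subseteq> {0..<int n} \<Longrightarrow> T \<subseteq> {0..<int n} \<Longrightarrow> bits n S = bits n T \<longleftrightarrow> S = T"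
  by (metis supp_bits)

lemma cyc_indep_subset: "cyc_indep n T \<Longrightarrow> S \<subseteq> T \<Longrightarrow> cyc_indep n S"
  by (auto simp: cyc_indep_def)

lemma cyc_indep_range: "cyc_indep n S \<Longrightarrow> S \<subseteq> {0..<int n}"
  by (simp add: cyc_indep_def)

lemma cyc_indep_empty [simp]: "cyc_indep n {}"
  by (simp add: cyc_indep_def)

lemma finite_cyc_indep: "finite {S. cyc_indep n S}"
  by (rule finite_subset[of _ "Pow {0..<int n}"]) (auto dest: cyc_indep_range)

text \<open>The case \<open>i = n - 1\<close> of the modular condition is the condition on the first
  and last digit. For \<open>n = 1\<close> position 0 is its own successor, so both sides exclude
  the string 1.\<close>

lemma lucas_bits_iff:
  assumes "n > 0" "S \<subseteq> {0..<int n}"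
  shows "lucas_string (bits n S) \<longleftrightarrow> cyc_indep n S"
proof -
  have ne: "bits n S \<noteq> []" using assms(1) by (simp add: bits_def)
  have hd: "hd (bits n S) \<longleftrightarrow> 0 \<in> S"
    using ne assms(1) by (simp add: hd_conv_nth)
  have last: "last (bits n S) \<longleftrightarrow> int n - 1 \<in> S"
    using ne assms(1) by (simp add: last_conv_nth of_nat_diff)
  have "lucas_string (bits n S) \<longleftrightarrow>
      (\<forall>i. Suc i < n \<longrightarrow> \<not> (int i \<in> S \<and> int i + 1 \<in> S)) \<and> \<not> (0 \<in> S \<and> int n - 1 \<in> S)"
    using ne by (auto simp: lucas_string_def hd last add.commute)
  also have "\<dots> \<longleftrightarrow> (\<forall>i\<in>S. (i + 1) mod int n \<notin> S)"
  proof (intro iffI ballI conjI allI impI; (elim conjE)?)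
    fix i assume h: "\<forall>i. Suc i < n \<longrightarrow> \<not> (int i \<in> S \<and> int i + 1 \<in> S)"
      "\<not> (0 \<in> S \<and> int n - 1 \<in> S)" and i: "i \<in> S"
    then have r: "0 \<le> i" "i < int n" using assms by auto
    show "(i + 1) mod int n \<notin> S"
    proof (cases "i = int n - 1")
      case True
      then show ?thesis using h(2) i by simp
    next
      case False
      then have "Suc (nat i) < n" using r by linarith
      then show ?thesis using h(1) i r False by (auto dest: spec[of _ "nat i"])
    qed
  next
    fix i assume h: "\<forall>i\<in>S. (i + 1) mod int n \<notin> S" and i: "Suc i < n"
    show "\<not> (int i \<in> S \<and> int i + 1 \<in> S)"
      using h[rule_format, of "int i"] i by auto
  next
    assume h: "\<forall>i\<in>S. (i + 1) mod int n \<notin> S"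
    show "\<not> (0 \<in> S \<and> int n - 1 \<in> S)"
      using h[rule_format, of "int n - 1"] by auto
  qed
  finally show ?thesis using assms(2) by (simp add: cyc_indep_def)
qed

section \<open>Vertices and edges of the Lucas cube in terms of sets\<close>

lemma verts_lucas_cube:
  assumes "n > 0"
  shows "verts (lucas_cube n) = bits n ` {S. cyc_indep n S}"
proof -
  have "u \<in> bits n ` {S. cyc_indep n S}" if "length u = n" "lucas_string u" for u
  proof -
    have "supp u \<subseteq> {0..<int n}" using that by (auto simp: supp_def)
    then have "cyc_indep n (supp u)"
      using lucas_bits_iff[OF assms, of "supp u"] that by (simp add: bits_supp)
    then show ?thesis using that by (metis bits_supp imageI mem_Collect_eq)
  qed
  then show ?thesis
    by (auto simp: lucas_cube_def induced_subgraph_def hypercube_def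
        lucas_bits_iff[OF assms] cyc_indep_range)
qed

text \<open>The symmetric difference links \<open>adj\<close> to the count of differing positions in
  \<open>hypercube\<close>, and injective maps preserve its size.\<close>

lemma adj_iff_card: "adj S T \<longleftrightarrow> card {x. (x \<in> S) \<noteq> (x \<in> T)} = 1"
proof
  assume "adj S T"
  then obtain x where "x \<notin> S \<and> T = insert x S \<or> x \<notin> T \<and> S = insert x T"
    by (auto simp: adj_def)
  then have "{x. (x \<in> S) \<noteq> (x \<in> T)} = {x}" by auto
  then show "card {x. (x \<in> S) \<noteq> (x \<in> T)} = 1" by simp
next
  assume "card {x. (x \<in> S) \<noteq> (x \<in> T)} = 1"
  then obtain x where x: "{x. (x \<in> S) \<noteq> (x \<in> T)} = {x}"
    by (auto simp: card_1_singleton_iff)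
  then have "(y \<in> S) \<noteq> (y \<in> T) \<longleftrightarrow> y = x" for y
    by (simp add: set_eq_iff)
  then have T: "y \<in> T \<longleftrightarrow> (if y = x then y \<notin> S else y \<in> S)" for y
    by metis
  show "adj S T"
  proof (cases "x \<in> S")
    case True
    then have "x \<notin> T" "S = insert x T" by (auto simp: T split: if_splits)
    then show ?thesis unfolding adj_def by blast
  next
    case False
    then have "x \<notin> S" "T = insert x S" by (auto simp: T split: if_splits)
    then show ?thesis unfolding adj_def by blast
  qed
qed

lemma adj_commute: "adj S T \<longleftrightarrow> adj T S"
  by (auto simp: adj_def)

lemma bits_edge_iff:
  assumes "n > 0" "cyc_indep n S" "cyc_indep n T"
  shows "{bits n S, bits n T} \<in> edges (lucas_cube n) \<longleftrightarrow> adj S T"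
proof -
  have card: "card {i. i < n \<and> bits n A ! i \<noteq> bits n B ! i} = card {x. (x \<in> A) \<noteq> (x \<in> B)}"
    if "A \<subseteq> {0..<int n}" "B \<subseteq> {0..<int n}" for A B
  proof -
    have "{x. (x \<in> A) \<noteq> (x \<in> B)} = int ` {i. i < n \<and> bits n A ! i \<noteq> bits n B ! i}"
    proof (rule Set.set_eqI)
      fix x
      show "x \<in> {x. (x \<in> A) \<noteq> (x \<in> B)} \<longleftrightarrow>
        x \<in> int ` {i. i < n \<and> bits n A ! i \<noteq> bits n B ! i}"
        using that by (cases x rule: int_cases) (auto simp: image_iff)
    qed
    then show ?thesis by (simp add: card_image)
  qed
  have r: "S \<subseteq> {0..<int n}" "T \<subseteq> {0..<int n}"
    using assms by (auto dest: cyc_indep_range)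
  have "lucas_string (bits n S)" "lucas_string (bits n T)"
    using assms r by (simp_all add: lucas_bits_iff)
  then have "{bits n S, bits n T} \<in> edges (lucas_cube n) \<longleftrightarrow>
      (\<exists>u v. {bits n S, bits n T} = {u, v} \<and> length u = n \<and> length v = n
        \<and> card {i. i < n \<and> u ! i \<noteq> v ! i} = 1)"
    by (auto simp: lucas_cube_def induced_subgraph_def hypercube_def)
  \<comment> \<open>An unordered pair matches \<open>{u, v}\<close> in two orders; the symmetry of
    \<open>adj\<close> merges the two disjuncts afterwards.\<close>
  also have "\<dots> \<longleftrightarrow> card {i. i < n \<and> bits n S ! i \<noteq> bits n T ! i} = 1 \<or>
      card {i. i < n \<and> bits n T ! i \<noteq> bits n S ! i} = 1"
  proof -
    have "(\<exists>u v. {a, b} = {u, v} \<and> P u v) \<longleftrightarrow> P a b \<or> P b a"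
      for a b :: "bool list" and P
      by (auto simp: doubleton_eq_iff)
    then show ?thesis by (simp only: length_bits simp_thms)
  qed
  also have "\<dots> \<longleftrightarrow> adj S T"
    unfolding card[OF r] card[OF r(2,1)] adj_iff_card[symmetric] using adj_commute by blast
  finally show ?thesis .
qed

lemma edges_lucas_cube:
  assumes "n > 0"
  shows "edges (lucas_cube n) = {bits_edge n S x | S x. x \<notin> S \<and> cyc_indep n (insert x S)}"
proof (intro equalityI subsetI)
  fix e assume e: "e \<in> edges (lucas_cube n)"
  with simple_graph_lucas_cube[of n] obtain u v
    where "e = {u, v}" "u \<in> verts (lucas_cube n)" "v \<in> verts (lucas_cube n)"
    unfolding simple_graph_def by (metis card_2_iff insert_subset)
  then obtain S T where ST: "e = {bits n S, bits n T}" "cyc_indep n S" "cyc_indep n T"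
    by (auto simp: verts_lucas_cube[OF assms])
  then have "adj S T" using e bits_edge_iff[OF assms] by simp
  then show "e \<in> {bits_edge n S x | S x. x \<notin> S \<and> cyc_indep n (insert x S)}"
    using ST unfolding adj_def bits_edge_def by (auto simp: insert_commute)
next
  fix e assume "e \<in> {bits_edge n S x | S x. x \<notin> S \<and> cyc_indep n (insert x S)}"
  then obtain S x where e: "e = bits_edge n S x" "x \<notin> S" "cyc_indep n (insert x S)" by blast
  then have "cyc_indep n S" by (auto intro: cyc_indep_subset)
  then show "e \<in> edges (lucas_cube n)"
    using e bits_edge_iff[OF assms, of S "insert x S"] by (auto simp: bits_edge_def adj_def)
qed

text \<open>Matching the endpoints crosswise would make each of \<open>S\<close> and
  \<open>T\<close> a proper subset of the other, so lower endpoint and added position can be read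
  off an edge.\<close>

lemma bits_edge_inject:
  assumes "insert x S \<subseteq> {0..<int n}" "insert y T \<subseteq> {0..<int n}" "x \<notin> S" "y \<notin> T"
    "bits_edge n S x = bits_edge n T y"
  shows "S = T \<and> x = y"
proof -
  have "S = T \<and> insert x S = insert y T \<or> S = insert y T \<and> insert x S = T"
    using assms by (auto simp: bits_edge_def doubleton_eq_iff bits_eq_iff)
  then show ?thesis using assms(3,4) by auto
qed

section \<open>Rotations and reflections as automorphisms\<close>

lemma dih_range: "n > 0 \<Longrightarrow> dih n k s i \<in> {0..<int n}"
  by (simp add: dih_def)

lemma dih_inject:
  assumes "s \<in> {1, -1}" "i \<in> {0..<int n}" "j \<in> {0..<int n}" "dih n k s i = dih n k s j"
  shows "i = j"
proof -
  have "int n dvd s * (i - j)"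
    using assms(4) by (simp add: dih_def mod_eq_dvd_iff algebra_simps)
  then have "int n dvd i - j" using assms(1) by (auto simp: dvd_diff_commute)
  then have "i mod int n = j mod int n" by (simp add: mod_eq_dvd_iff)
  then show ?thesis using assms(2,3) by simp
qed

lemma inj_on_dih: "s \<in> {1, -1} \<Longrightarrow> inj_on (dih n k s) {0..<int n}"
  by (rule inj_onI) (rule dih_inject)

lemma dih_mod: "dih n (k mod int n) s i = dih n k s i"
  by (simp add: dih_def mod_simps)

lemma dih_1_dih: "dih n m 1 (dih n k s i) = dih n (m + k) s i"
  by (simp add: dih_def mod_simps algebra_simps)

lemma cyc_indep_dih:
  assumes "n > 0" "s \<in> {1, -1}" "cyc_indep n S"
  shows "cyc_indep n (dih n k s ` S)"
proof -
  have "(dih n k s i + 1) mod int n \<notin> dih n k s ` S" if i: "i \<in> S" for i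
  proof
    assume "(dih n k s i + 1) mod int n \<in> dih n k s ` S"
    then obtain j where j: "j \<in> S" "(dih n k s i + 1) mod int n = dih n k s j" by auto
    then have "int n dvd s * (i - j) + 1"
      by (simp add: dih_def mod_simps mod_eq_dvd_iff algebra_simps)
    \<comment> \<open>The first case arises for \<open>s = 1\<close>; for \<open>s = -1\<close> the
      reflection reverses which position is the successor.\<close>
    then have "int n dvd (i + 1) - j \<or> int n dvd (j + 1) - i"
      using assms(2) by (auto simp: algebra_simps)
    moreover have "i \<in> {0..<int n}" "j \<in> {0..<int n}"
      using i j assms cyc_indep_range by blast+
    ultimately have "(i + 1) mod int n = j \<or> (j + 1) mod int n = i"
      by (simp add: mod_eq_dvd_iff[symmetric])
    then show False using i j assms(3) by (auto simp: cyc_indep_def)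
  qed
  then show ?thesis using dih_range[OF assms(1)] by (auto simp: cyc_indep_def)
qed

text \<open>Restricted to the vertices because members of \<open>Bij\<close> are
  extensional.\<close>

definition dih_aut :: "nat \<Rightarrow> int \<Rightarrow> int \<Rightarrow> bool list \<Rightarrow> bool list"
  where "dih_aut n k s = (\<lambda>u\<in>verts (lucas_cube n). bits n (dih n k s ` supp u))"

lemma dih_aut_bits:
  assumes "n > 0" "cyc_indep n S"
  shows "dih_aut n k s (bits n S) = bits n (dih n k s ` S)"
  using assms by (simp add: dih_aut_def verts_lucas_cube supp_bits cyc_indep_range)

lemma adj_image_iff:
  assumes "inj_on f A" "S \<subseteq> A" "T \<subseteq> A"
  shows "adj (f ` S) (f ` T) \<longleftrightarrow> adj S T"
proof -
  have "{x. (x \<in> f ` S) \<noteq> (x \<in> f ` T)} = f ` {x. (x \<in> S) \<noteq> (x \<in> T)}"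
    using assms by (auto simp: inj_on_def image_iff subset_iff)
  moreover have "inj_on f {x. (x \<in> S) \<noteq> (x \<in> T)}"
    using assms by (auto simp: inj_on_def)
  ultimately show ?thesis by (simp add: adj_iff_card card_image)
qed

lemma dih_aut_automorphism:
  assumes n: "n > 0" and s: "s \<in> {1, -1}"
  shows "dih_aut n k s \<in> graph_automorphisms (lucas_cube n)"
proof -
  let ?V = "verts (lucas_cube n)"
  have "dih_aut n k s ` ?V \<subseteq> ?V"
    using n s by (auto simp: verts_lucas_cube dih_aut_bits cyc_indep_dih)
  moreover have "inj_on (dih_aut n k s) ?V"
  proof (rule inj_onI)
    fix u v assume "u \<in> ?V" "v \<in> ?V" and eq: "dih_aut n k s u = dih_aut n k s v"
    then obtain S T where ST: "cyc_indep n S" "cyc_indep n T" "u = bits n S" "v = bits n T"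
      by (auto simp: verts_lucas_cube[OF n])
    then have "dih n k s ` S = dih n k s ` T"
      using eq n s by (simp add: dih_aut_bits bits_eq_iff cyc_indep_dih cyc_indep_range)
    then have "S = T"
      using inj_on_image_eq_iff[OF inj_on_dih[OF s]] ST cyc_indep_range by metis
    then show "u = v" using ST by simp
  qed
  \<comment> \<open>An injective self-map of a finite set is onto.\<close>
  moreover have "finite ?V" by (simp add: verts_lucas_cube[OF n] finite_cyc_indep)
  ultimately have "bij_betw (dih_aut n k s) ?V ?V"
    by (simp add: bij_betw_def endo_inj_surj)
  then have "dih_aut n k s \<in> Bij ?V"
    by (simp add: Bij_def dih_aut_def)
  moreover have "{u, v} \<in> edges (lucas_cube n) \<longleftrightarrow>
      {dih_aut n k s u, dih_aut n k s v} \<in> edges (lucas_cube n)" if uv: "u \<in> ?V" "v \<in> ?V" for u v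
  proof -
    obtain S T where ST: "cyc_indep n S" "cyc_indep n T" "u = bits n S" "v = bits n T"
      using uv by (auto simp: verts_lucas_cube[OF n])
    then show ?thesis
      using n s
      by (simp add: dih_aut_bits bits_edge_iff cyc_indep_dih
          adj_image_iff[OF inj_on_dih] cyc_indep_range)
  qed
  ultimately show ?thesis by (simp add: graph_automorphisms_def)
qed

section \<open>Neighbourhoods and the rigidity of automorphisms\<close>

lemma adj_differ_unique:
  "adj U V \<Longrightarrow> (u \<in> U) \<noteq> (u \<in> V) \<Longrightarrow> (v \<in> U) \<noteq> (v \<in> V) \<Longrightarrow> u = v"
  unfolding adj_def by blast

text \<open>Two vertices of a cube at distance 2 have exactly two common neighbours, here
  \<open>R\<close> below and \<open>insert a (insert b R)\<close> above. The case
  \<open>R = {}\<close> recovers the cycle from the weight-1 strings, and larger \<open>R\<close>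
  drive the induction on the weight.\<close>

lemma adj_common_neighbour:
  assumes "adj U (insert a R)" "adj U (insert b R)" "a \<noteq> b" "a \<notin> R" "b \<notin> R" "U \<noteq> R"
  shows "U = insert a (insert b R)"
proof -
  note da = adj_differ_unique[OF assms(1)] and db = adj_differ_unique[OF assms(2)]
  have "a \<in> U"
  proof (rule ccontr)
    \<comment> \<open>Then \<open>a\<close> is the single difference between \<open>U\<close> and
      \<open>insert a R\<close>, which leaves \<open>U = R\<close>.\<close>
    assume a: "a \<notin> U"
    then have "c \<in> U \<longleftrightarrow> c \<in> R" for c
      using da[of a c] assms(4) by (cases "c = a") auto
    then show False using assms(6) by blast
  qed
  moreover have "b \<in> U"
  proof (rule ccontr)
    assume b: "b \<notin> U"
    then have "c \<in> U \<longleftrightarrow> c \<in> R" for c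
      using db[of b c] assms(5) by (cases "c = b") auto
    then show False using assms(6) by blast
  qed
  ultimately have "c \<in> U \<longleftrightarrow> c = a \<or> c = b \<or> c \<in> R" for c
    using da[of b c] assms(3,5) by (cases "c = a"; cases "c = b") auto
  then show ?thesis by blast
qed

lemma adj_empty_iff: "adj {} T \<longleftrightarrow> (\<exists>x. T = {x})"
  by (auto simp: adj_def)

lemma cyc_indep_singleton:
  assumes "n \<ge> 2" "x \<in> {0..<int n}"
  shows "cyc_indep n {x}"
proof -
  have "(x + 1) mod int n \<noteq> x"
    using assms by (cases "x = int n - 1") (auto simp: mod_pos_pos_trivial)
  then show ?thesis using assms by (simp add: cyc_indep_def)
qed

text \<open>A neighbour is determined by the position that is flipped, and the successor of a member
  of \<open>S\<close> can never be flipped: it is outside \<open>S\<close>, and adding it breaks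
  independence.\<close>

lemma card_adj_less:
  assumes n: "n > 0" and S: "cyc_indep n S" "S \<noteq> {}"
  shows "card {T. cyc_indep n T \<and> adj S T} < n"
proof -
  obtain i where i: "i \<in> S" using S by auto
  let ?j = "(i + 1) mod int n"
  let ?f = "\<lambda>x. if x \<in> S then S - {x} else insert x S"
  have j: "?j \<in> {0..<int n}" using n by simp
  have "{T. cyc_indep n T \<and> adj S T} \<subseteq> ?f ` ({0..<int n} - {?j})"
  proof
    fix T assume "T \<in> {T. cyc_indep n T \<and> adj S T}"
    then have T: "cyc_indep n T" "adj S T" by auto
    obtain x where x: "x \<notin> S \<and> T = insert x S \<or> x \<notin> T \<and> S = insert x T"
      using T(2) by (auto simp: adj_def)
    then have "T = ?f x" by auto
    moreover have "x \<in> {0..<int n}" using x T S cyc_indep_range by blast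
    moreover have "x \<noteq> ?j"
      using x i S(1) T(1) unfolding cyc_indep_def by blast
    ultimately show "T \<in> ?f ` ({0..<int n} - {?j})" by blast
  qed
  then have "card {T. cyc_indep n T \<and> adj S T} \<le> card ({0..<int n} - {?j})"
    by (rule surj_card_le[rotated]) simp
  also have "\<dots> = n - 1" using j by simp
  finally show ?thesis using n by simp
qed

text \<open>Walking along \<open>0, 1, ...\<close>, the first step of \<open>p\<close> fixes the
  direction \<open>s\<close>, and injectivity forbids turning back.\<close>

lemma cycle_automorphism_dih:
  fixes p :: "int \<Rightarrow> int"
  assumes n: "n > 0"
    and r: "\<And>i. i \<in> {0..<int n} \<Longrightarrow> p i \<in> {0..<int n}"
    and inj: "inj_on p {0..<int n}"
    and adj: "\<And>i. 0 \<le> i \<Longrightarrow> i + 1 < int n \<Longrightarrow>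
      p (i + 1) = (p i + 1) mod int n \<or> p i = (p (i + 1) + 1) mod int n"
  shows "\<exists>k. \<exists>s\<in>{1, -1}. \<forall>i\<in>{0..<int n}. p i = dih n k s i"
proof -
  have step: "p (i + 1) = (p i + 1) mod int n \<or> p (i + 1) = (p i - 1) mod int n"
    if "0 \<le> i" "i + 1 < int n" for i
  proof -
    have "p (i + 1) = (p (i + 1) + 1 - 1) mod int n"
      using r[of "i + 1"] that by simp
    also have "\<dots> = ((p (i + 1) + 1) mod int n - 1) mod int n" by (simp add: mod_simps)
    finally show ?thesis using adj[OF that] by metis
  qed
  \<comment> \<open>For \<open>n = 1\<close> there is no first step and either sign will do, hence
    the conditional equation.\<close>
  obtain s :: int where s: "s \<in> {1, -1}" and s1: "int n > 1 \<Longrightarrow> p 1 = (p 0 + s) mod int n"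
    using step[of 0] by fastforce
  have "int m < int n \<longrightarrow> p (int m) = dih n (p 0) s (int m)" for m
  proof (induction m rule: less_induct)
    case (less m)
    consider "m = 0" | "m = 1" | l where "m = Suc (Suc l)"
      by (metis One_nat_def not0_implies_Suc)
    then show ?case
    proof cases
      case 1
      then show ?thesis using r[of 0] n by (simp add: dih_def)
    next
      case 2
      then show ?thesis using s1 by (simp add: dih_def)
    next
      case 3
      show ?thesis
      proof
        assume m: "int m < int n"
        have l: "p (int l) = dih n (p 0) s (int l)"
            "p (int l + 1) = dih n (p 0) s (int l + 1)"
          using less.IH[of l] less.IH[of "Suc l"] 3 m by (simp_all add: add.commute)
        have mm: "int m = int l + 1 + 1" using 3 by simp
        have ne: "p (int m) \<noteq> p (int l)"
          using inj_onD[OF inj, of "int m" "int l"] 3 m by auto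
        have "p (int m) = (p (int l + 1) + s) mod int n \<or> p (int m) = (p (int l + 1) - s) mod int n"
          using step[of "int l + 1"] s m unfolding mm by auto
        \<comment> \<open>A step against the direction \<open>s\<close> returns to the position
          visited two steps earlier.\<close>
        moreover have "(p (int l + 1) - s) mod int n = p (int l)"
          unfolding l dih_def by (simp only: mod_diff_left_eq) (simp add: algebra_simps)
        ultimately have "p (int m) = (p (int l + 1) + s) mod int n" using ne by simp
        then show "p (int m) = dih n (p 0) s (int m)"
          unfolding mm l dih_def by (simp only: mod_add_left_eq) (simp add: algebra_simps)
      qed
    qed
  qed
  then have "\<forall>i\<in>{0..<int n}. p i = dih n (p 0) s i"
    by (metis atLeastLessThan_iff nonneg_int_cases)
  then show ?thesis using s by blast
qed

lemma cyc_indep_automorphism_dih: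
  assumes n: "n > 0"
    and bij: "bij_betw H {S. cyc_indep n S} {S. cyc_indep n S}"
    and adj: "\<And>S T. cyc_indep n S \<Longrightarrow> cyc_indep n T \<Longrightarrow> adj (H S) (H T) \<longleftrightarrow> adj S T"
  shows "\<exists>k. \<exists>s\<in>{1, -1}. \<forall>S. cyc_indep n S \<longrightarrow> H S = dih n k s ` S"
proof (cases "n = 1")
  case True
  \<comment> \<open>For \<open>n = 1\<close> the cube has a single vertex, so any \<open>k\<close>
    and \<open>s\<close> serve.\<close>
  have "S = {}" if "cyc_indep n S" for S
  proof -
    have "x = 0" if "x \<in> S" for x
      using that True cyc_indep_range[OF \<open>cyc_indep n S\<close>] by fastforce
    moreover have "0 \<notin> S"
      using that True by (fastforce simp: cyc_indep_def)
    ultimately show ?thesis by blast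
  qed
  moreover have "cyc_indep n (H {})" using bij bij_betwE by fastforce
  ultimately have "H S = dih n 0 1 ` S" if "cyc_indep n S" for S
    using that by (metis image_empty)
  then show ?thesis by blast
next
  case False
  with n have n2: "n \<ge> 2" by simp
  have HI: "cyc_indep n (H S)" if "cyc_indep n S" for S
    using bij that bij_betwE by fastforce
  have Hinj: "H S = H T \<longleftrightarrow> S = T" if "cyc_indep n S" "cyc_indep n T" for S T
    using bij that by (auto simp: bij_betw_def inj_on_def)
  have Hsurj: "\<exists>S. cyc_indep n S \<and> H S = T" if "cyc_indep n T" for T
    using bij that by (metis (lifting) bij_betw_def imageE mem_Collect_eq)
  have single: "cyc_indep n {x} \<longleftrightarrow> x \<in> {0..<int n}" for x
    using cyc_indep_singleton[OF n2] by (auto simp: cyc_indep_def)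
  \<comment> \<open>The \<open>n\<close> singletons are neighbours of \<open>{}\<close>, so
    \<open>H {}\<close> has at least \<open>n\<close> neighbours, too many for a nonempty
    set.\<close>
  have H0: "H {} = {}"
  proof (rule ccontr)
    assume "H {} \<noteq> {}"
    then have "card {T. cyc_indep n T \<and> adj (H {}) T} < n"
      by (intro card_adj_less n HI) auto
    moreover have "(\<lambda>x. H {x}) ` {0..<int n} \<subseteq> {T. cyc_indep n T \<and> adj (H {}) T}"
      by (auto simp: HI adj single adj_empty_iff)
    moreover have "inj_on (\<lambda>x. H {x}) {0..<int n}"
      by (rule inj_onI) (simp add: Hinj single)
    moreover have "finite {T. cyc_indep n T \<and> adj (H {}) T}"
      using finite_cyc_indep by (rule rev_finite_subset) auto
    ultimately have "card {0..<int n} < n"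
      by (metis (no_types, lifting) card_image card_mono le_less_trans)
    then show False by simp
  qed
  have "\<exists>y. H {x} = {y}" if "x \<in> {0..<int n}" for x
    using adj[of "{}" "{x}"] that by (simp add: H0 adj_empty_iff single)
  then obtain p where p: "\<And>x. x \<in> {0..<int n} \<Longrightarrow> H {x} = {p x}" by metis
  have pr: "p i \<in> {0..<int n}" if "i \<in> {0..<int n}" for i
    using HI[of "{i}"] that by (simp add: p single)
  have pinj: "inj_on p {0..<int n}"
  proof (rule inj_onI)
    fix x y assume "x \<in> {0..<int n}" "y \<in> {0..<int n}" "p x = p y"
    then show "x = y" using Hinj[of "{x}" "{y}"] by (simp add: p single)
  qed
  \<comment> \<open>The preimage of \<open>{p i, p j}\<close> is a common neighbour of
    \<open>{i}\<close> and \<open>{j}\<close> other than \<open>{}\<close>, hence equals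
    \<open>{i, j}\<close>. Contrapositively, \<open>p\<close> sends adjacent positions to adjacent
    ones.\<close>
  have pair: "cyc_indep n {i, j}"
    if ij: "i \<in> {0..<int n}" "j \<in> {0..<int n}" "i \<noteq> j" and c: "cyc_indep n {p i, p j}" for i j
  proof -
    obtain T where T: "cyc_indep n T" "H T = {p i, p j}" using Hsurj[OF c] by auto
    have "p i \<noteq> p j" using inj_on_eq_iff[OF pinj ij(1,2)] ij(3) by simp
    then have "adj {p i} {p i, p j}" "adj {p j} {p i, p j}"
      unfolding adj_def by (metis insert_commute singletonD)+
    then have "adj {i} T" "adj {j} T"
      using adj[of "{i}" T] adj[of "{j}" T] T ij by (simp_all add: p single)
    moreover have "T \<noteq> {}" using T(2) H0 by auto
    ultimately have "T = {i, j}"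
      using adj_common_neighbour[of T i "{}" j] ij(3) adj_commute by blast
    then show ?thesis using T by simp
  qed
  have "p (i + 1) = (p i + 1) mod int n \<or> p i = (p (i + 1) + 1) mod int n"
    if i: "0 \<le> i" "i + 1 < int n" for i
  proof (rule ccontr)
    assume c: "\<not> ?thesis"
    have "p i \<in> {0..<int n}" "p (i + 1) \<in> {0..<int n}" using pr i by auto
    then have "cyc_indep n {p i}" "cyc_indep n {p (i + 1)}" by (simp_all only: single)
    then have "cyc_indep n {p i, p (i + 1)}" using c by (auto simp: cyc_indep_def)
    then have "cyc_indep n {i, i + 1}" using pair[of i "i + 1"] i by simp
    then show False using i by (auto simp: cyc_indep_def)
  qed
  then obtain k s where s: "s \<in> {1, -1}" and k: "\<And>i. i \<in> {0..<int n} \<Longrightarrow> p i = dih n k s i"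
    using cycle_automorphism_dih[OF n pr pinj] by metis
  have "cyc_indep n S \<longrightarrow> H S = p ` S" if "finite S" for S
    using that
  proof (induction S rule: finite_psubset_induct)
    case (psubset S)
    show ?case
    proof
      assume S: "cyc_indep n S"
      have sub: "S \<subseteq> {0..<int n}" using S by (rule cyc_indep_range)
      show "H S = p ` S"
      proof (cases "\<exists>x\<in>S. \<exists>y\<in>S. x \<noteq> y")
        case False
        then consider "S = {}" | x where "S = {x}" by blast
        then show ?thesis using H0 p sub by cases auto
      next
        case True
        then obtain x y where xy: "x \<in> S" "y \<in> S" "x \<noteq> y" by auto
        have IH: "H T = p ` T" if "T \<subset> S" for T
          using psubset.IH[OF that] cyc_indep_subset[OF S] that by auto
        have ind: "cyc_indep n T" if "T \<subseteq> S" for T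
          using cyc_indep_subset[OF S that] .
        have down: "adj (H S) (p ` (S - {z}))" if z: "z \<in> S" for z
        proof -
          have "adj S (S - {z})" using z unfolding adj_def by blast
          then have "adj (H S) (H (S - {z}))" using adj S ind[of "S - {z}"] by blast
          moreover have "H (S - {z}) = p ` (S - {z})" using z by (intro IH) blast
          ultimately show ?thesis by simp
        qed
        have ne: "H S \<noteq> p ` (S - {x, y})"
        proof -
          have "H (S - {x, y}) = p ` (S - {x, y})" using xy by (intro IH) blast
          moreover have "H S \<noteq> H (S - {x, y})"
            using Hinj[OF S ind[of "S - {x, y}"]] xy by blast
          ultimately show ?thesis by simp
        qed
        define R where "R = p ` (S - {x, y})"
        have in_R: "p z \<in> R \<longleftrightarrow> z \<in> S - {x, y}" if "z \<in> S" for z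
          using inj_on_image_mem_iff[OF pinj, of z "S - {x, y}"] that sub unfolding R_def by blast
        have eqs: "p ` (S - {x}) = insert (p y) R" "p ` (S - {y}) = insert (p x) R"
            "p ` S = insert (p x) (insert (p y) R)"
          using xy unfolding R_def by auto
        have "p x \<notin> R" "p y \<notin> R" using in_R xy by auto
        moreover have "p x \<noteq> p y"
          using inj_on_eq_iff[OF inj_on_subset[OF pinj sub] xy(1,2)] xy(3) by simp
        ultimately show ?thesis
          using down[OF xy(1)] down[OF xy(2)] ne adj_common_neighbour[of "H S" "p x" R "p y"]
          unfolding eqs R_def[symmetric] by blast
      qed
    qed
  qed
  then have "H S = dih n k s ` S" if "cyc_indep n S" for S
    using that k cyc_indep_range[OF that] finite_subset[OF cyc_indep_range[OF that]]
    by (auto intro!: image_cong)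
  then show ?thesis using s by blast
qed

lemma graph_automorphism_dih:
  assumes n: "n > 0" and g: "g \<in> graph_automorphisms (lucas_cube n)"
  shows "\<exists>k. \<exists>s\<in>{1, -1}. \<forall>S. cyc_indep n S \<longrightarrow> g (bits n S) = bits n (dih n k s ` S)"
proof -
  \<comment> \<open>\<open>H\<close> is \<open>g\<close> transported to independent sets along
    \<open>bits n\<close> and its inverse \<open>supp\<close>.\<close>
  define H where "H S = supp (g (bits n S))" for S
  let ?V = "verts (lucas_cube n)" and ?I = "{S. cyc_indep n S}"
  have gb: "bij_betw g ?V ?V" using g by (simp add: graph_automorphisms_def Bij_def)
  have b: "bij_betw (bits n) ?I ?V"
    by (auto simp: bij_betw_def verts_lucas_cube[OF n] bits_eq_iff cyc_indep_range intro!: inj_onI)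
  have "bij_betw supp ?V ?I"
    by (rule bij_betw_byWitness[where f' = "bits n"])
       (auto simp: verts_lucas_cube[OF n] supp_bits cyc_indep_range)
  then have Hbij: "bij_betw H ?I ?I"
    using bij_betw_trans[OF bij_betw_trans[OF b gb], of supp ?I]
    by (simp add: H_def[abs_def] comp_def)
  have bH: "bits n (H S) = g (bits n S)" if "cyc_indep n S" for S
  proof -
    have "g (bits n S) \<in> ?V" using gb b that by (auto dest!: bij_betwE)
    then show ?thesis unfolding H_def by (auto simp: verts_lucas_cube[OF n] bits_supp)
  qed
  have "adj (H S) (H T) \<longleftrightarrow> adj S T" if ST: "cyc_indep n S" "cyc_indep n T" for S T
  proof -
    have "cyc_indep n (H S)" "cyc_indep n (H T)" using Hbij ST by (auto dest!: bij_betwE)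
    then have "adj (H S) (H T) \<longleftrightarrow> {g (bits n S), g (bits n T)} \<in> edges (lucas_cube n)"
      using bits_edge_iff[OF n, of "H S" "H T"] ST by (simp add: bH)
    also have "\<dots> \<longleftrightarrow> {bits n S, bits n T} \<in> edges (lucas_cube n)"
      using g ST by (auto simp: graph_automorphisms_def verts_lucas_cube[OF n])
    also have "\<dots> \<longleftrightarrow> adj S T" using bits_edge_iff[OF n] ST by simp
    finally show ?thesis .
  qed
  then obtain k s where "s \<in> {1, -1}" "\<And>S. cyc_indep n S \<Longrightarrow> H S = dih n k s ` S"
    using cyc_indep_automorphism_dih[OF n Hbij] by metis
  then show ?thesis using bH by metis
qed

section \<open>Edge orbits and their sizes\<close>

definition dih_pairs :: "nat \<Rightarrow> int set \<Rightarrow> int \<Rightarrow> int \<Rightarrow> (int set \<times> int) set"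
  where "dih_pairs n S x s = range (\<lambda>k. (dih n k s ` S, dih n k s x))"

lemma orbit_bits_edge:
  assumes n: "n > 0" and S: "cyc_indep n (insert x S)" "x \<notin> S"
  shows "orbit (Aut (lucas_cube n)) (edge_action (lucas_cube n)) (bits_edge n S x)
    = (\<lambda>(T, y). bits_edge n T y) ` (dih_pairs n S x 1 \<union> dih_pairs n S x (-1))" (is "?L = ?R")
proof -
  have S': "cyc_indep n S" using S by (auto intro: cyc_indep_subset)
  have e: "bits_edge n S x \<in> edges (lucas_cube n)"
    using S by (auto simp: edges_lucas_cube[OF n])
  have L: "?L = {g ` bits_edge n S x | g. g \<in> graph_automorphisms (lucas_cube n)}"
    using e by (simp add: orbit_def Aut_def edge_action_def)
  have R: "?R = {bits_edge n (dih n k s ` S) (dih n k s x) | k s. s \<in> {1, -1}}"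
    by (auto simp: dih_pairs_def image_Un)
  show ?thesis
    unfolding L R
  proof (intro equalityI subsetI; clarify)
    fix g assume "g \<in> graph_automorphisms (lucas_cube n)"
    then obtain k s where s: "s \<in> {1, -1}"
      and k: "\<And>S. cyc_indep n S \<Longrightarrow> g (bits n S) = bits n (dih n k s ` S)"
      using graph_automorphism_dih[OF n] by metis
    then show "\<exists>k s. g ` bits_edge n S x = bits_edge n (dih n k s ` S) (dih n k s x)
        \<and> s \<in> {1, -1}"
      by (intro exI[of _ k] exI[of _ s]) (simp add: bits_edge_def k[OF S'] k[OF S(1)])
  next
    fix k s :: int assume s: "s \<in> {1, -1}"
    show "\<exists>g. bits_edge n (dih n k s ` S) (dih n k s x) = g ` bits_edge n S x
        \<and> g \<in> graph_automorphisms (lucas_cube n)"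
      by (intro exI[of _ "dih_aut n k s"])
         (simp add: dih_aut_automorphism[OF n s] bits_edge_def dih_aut_bits[OF n] S S')
  qed
qed

text \<open>The image of \<open>x\<close> alone determines \<open>k\<close> modulo \<open>n\<close>,
  so distinct residues give distinct pairs whatever \<open>S\<close> is.\<close>

lemma card_dih_pairs:
  assumes n: "n > 0"
  shows "finite (dih_pairs n S x s)" "card (dih_pairs n S x s) = n"
proof -
  let ?f = "\<lambda>k. (dih n k s ` S, dih n k s x)"
  have "?f k \<in> ?f ` {0..<int n}" for k
    using n by (intro image_eqI[of _ _ "k mod int n"]) (simp_all add: dih_mod)
  then have eq: "dih_pairs n S x s = ?f ` {0..<int n}"
    unfolding dih_pairs_def by blast
  then show "finite (dih_pairs n S x s)" by simp
  have "inj_on ?f {0..<int n}"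
  proof (rule inj_onI)
    fix k l assume kl: "k \<in> {0..<int n}" "l \<in> {0..<int n}" "?f k = ?f l"
    then have "k mod int n = l mod int n"
    proof -
      have "dih n k s x = dih n l s x" using kl(3) by simp
      then show ?thesis by (simp add: dih_def mod_eq_dvd_iff)
    qed
    then show "k = l" using kl by simp
  qed
  then show "card (dih_pairs n S x s) = n" by (simp add: eq card_image)
qed

text \<open>For either sign the set is an orbit of the group of rotations, and orbits that meet
  coincide.\<close>

lemma dih_pairs_eq_or_disjoint:
  assumes n: "n > 0" and ne: "dih_pairs n S x s \<inter> dih_pairs n S x t \<noteq> {}"
  shows "dih_pairs n S x s = dih_pairs n S x t"
proof -
  obtain k l where kl: "dih n k s ` S = dih n l t ` S" "dih n k s x = dih n l t x"
    using ne by (auto simp: dih_pairs_def)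
  \<comment> \<open>Rotating the common pair by \<open>m - k\<close> turns the parameter
    \<open>k\<close> into \<open>m\<close> and \<open>l\<close> into
    \<open>m - k + l\<close>.\<close>
  have "(dih n m s ` S, dih n m s x) = (dih n (m - k + l) t ` S, dih n (m - k + l) t x)" for m
  proof -
    have sh: "dih n m s = dih n (m - k) 1 \<circ> dih n k s"
      "dih n (m - k + l) t = dih n (m - k) 1 \<circ> dih n l t"
      by (simp_all add: fun_eq_iff dih_1_dih)
    show ?thesis unfolding sh image_comp[symmetric] using kl by simp
  qed
  then have "dih_pairs n S x s \<subseteq> dih_pairs n S x t"
    unfolding dih_pairs_def by blast
  then show ?thesis
    using card_dih_pairs[OF n] by (metis card_subset_eq)
qed

lemma card_orbit:
  assumes n: "n > 0" and S: "cyc_indep n (insert x S)" "x \<notin> S"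
  shows "card (orbit (Aut (lucas_cube n)) (edge_action (lucas_cube n)) (bits_edge n S x))
    = (if dih_pairs n S x 1 = dih_pairs n S x (-1) then n else 2 * n)"
proof -
  let ?D = "dih_pairs n S x 1 \<union> dih_pairs n S x (-1)"
  \<comment> \<open>These are the side conditions of \<open>bits_edge_inject\<close>, which allows
    counting pairs instead of edges.\<close>
  have D: "insert y T \<subseteq> {0..<int n} \<and> y \<notin> T" if Ty: "(T, y) \<in> ?D" for T y
  proof -
    obtain k s where s: "s \<in> {1, -1}" "T = dih n k s ` S" "y = dih n k s x"
      using Ty by (auto simp: dih_pairs_def)
    have "y \<notin> T"
    proof
      assume "y \<in> T"
      then obtain z where "z \<in> S" "dih n k s x = dih n k s z" using s by auto
      then show False using dih_inject[OF s(1)] cyc_indep_range[OF S(1)] S(2) by blast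
    qed
    then show ?thesis using s dih_range[OF n] by auto
  qed
  have "inj_on (\<lambda>(T, y). bits_edge n T y) ?D"
  proof (rule inj_onI)
    fix a b assume ab: "a \<in> ?D" "b \<in> ?D"
      "(\<lambda>(T, y). bits_edge n T y) a = (\<lambda>(T, y). bits_edge n T y) b"
    obtain T y T' y' where "a = (T, y)" "b = (T', y')" by fastforce
    then show "a = b"
      using ab D[of T y] D[of T' y'] bits_edge_inject[of y T n y' T'] by simp
  qed
  then have "card (orbit (Aut (lucas_cube n)) (edge_action (lucas_cube n)) (bits_edge n S x)) = card ?D"
    by (simp only: orbit_bits_edge[OF n S] card_image)
  also have "\<dots> = (if dih_pairs n S x 1 = dih_pairs n S x (-1) then n else 2 * n)"
  proof (cases "dih_pairs n S x 1 = dih_pairs n S x (-1)")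
    case True
    then show ?thesis by (simp add: card_dih_pairs[OF n])
  next
    case False
    then have "dih_pairs n S x 1 \<inter> dih_pairs n S x (-1) = {}"
      using dih_pairs_eq_or_disjoint[OF n] by blast
    then show ?thesis using False by (simp add: card_dih_pairs[OF n] card_Un_disjoint)
  qed
  finally show ?thesis .
qed

text \<open>A member of \<open>S\<close> differs from \<open>x\<close> and is not adjacent to it.
  For \<open>n \<le> 3\<close> no such position exists; for \<open>n = 4\<close> it is the one
  opposite \<open>x\<close>, which the reflection about \<open>x\<close> fixes.\<close>

lemma dih_pairs_eq_if_le_4:
  assumes n: "n > 0" "n \<le> 4" and S: "cyc_indep n (insert x S)" "x \<notin> S"
  shows "dih_pairs n S x 1 = dih_pairs n S x (-1)"
proof -
  have "dih n 0 1 y = dih n (2 * x) (-1) y" if y: "y \<in> S" for y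
  proof -
    have "y \<noteq> x" using y S(2) by auto
    moreover have "(x + 1) mod int n \<noteq> y" "(y + 1) mod int n \<noteq> x"
      using y S(1) unfolding cyc_indep_def by blast+
    moreover have "0 \<le> x" "x < int n" "0 \<le> y" "y < int n"
      using y cyc_indep_range[OF S(1)] by auto
    moreover have "n \<in> {1, 2, 3, 4}" using n by auto
    moreover from calculation n(2) have "x \<in> {0, 1, 2, 3}" "y \<in> {0, 1, 2, 3}" by auto
    ultimately show ?thesis
      unfolding dih_def by (elim insertE emptyE) simp_all
  qed
  then have S: "dih n 0 1 ` S = dih n (2 * x) (-1) ` S" by (intro image_cong) auto
  have x: "dih n 0 1 x = dih n (2 * x) (-1) x" by (simp add: dih_def)
  \<comment> \<open>One common pair suffices, since sets that meet are equal.\<close>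
  have "(dih n 0 1 ` S, dih n 0 1 x) \<in> dih_pairs n S x (-1)"
    unfolding dih_pairs_def by (rule range_eqI[of _ _ "2 * x"]) (simp only: S x)
  moreover have "(dih n 0 1 ` S, dih n 0 1 x) \<in> dih_pairs n S x 1"
    unfolding dih_pairs_def by blast
  ultimately have "dih_pairs n S x 1 \<inter> dih_pairs n S x (-1) \<noteq> {}" by blast
  then show ?thesis by (rule dih_pairs_eq_or_disjoint[OF n(1)])
qed

text \<open>A reflection fixing both 0 and 2 would need \<open>k\<close> congruent to 0 and to 4
  modulo \<open>n\<close>, hence \<open>n\<close> dividing 4.\<close>

lemma dih_pairs_neq:
  assumes n: "n \<ge> 5"
  shows "dih_pairs n {2} 0 1 \<noteq> dih_pairs n {2} 0 (-1)"
proof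
  assume eq: "dih_pairs n {2} 0 1 = dih_pairs n {2} 0 (-1)"
  have "(dih n 0 1 ` {2}, dih n 0 1 0) \<in> dih_pairs n {2} 0 1"
    unfolding dih_pairs_def by blast
  with eq obtain k where "dih n 0 1 2 = dih n k (-1) 2" "dih n 0 1 0 = dih n k (-1) 0"
    unfolding dih_pairs_def by auto
  then have "int n dvd 2 - (k - 2)" "int n dvd k"
    by (auto simp: dih_def mod_eq_dvd_iff dvd_eq_mod_eq_0)
  then have "int n dvd 2 - (k - 2) + k" by (rule dvd_add)
  then have "int n dvd 4" by simp
  then show False using n zdvd_imp_le[of "int n" 4] by simp
qed

theorem theorem5p10:
  fixes n :: nat
  assumes "n > 0"
  shows "card ` orbits (Aut (lucas_cube n)) (edges (lucas_cube n)) (edge_action (lucas_cube n))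
           \<subseteq> {n, 2 * n} \<and>
         (card ` orbits (Aut (lucas_cube n)) (edges (lucas_cube n)) (edge_action (lucas_cube n))
           = {n, 2 * n} \<longleftrightarrow> n \<ge> 5)"
proof -
  let ?C = "card ` orbits (Aut (lucas_cube n)) (edges (lucas_cube n)) (edge_action (lucas_cube n))"
  have C: "?C = {if dih_pairs n S x 1 = dih_pairs n S x (-1) then n else 2 * n | S x.
      x \<notin> S \<and> cyc_indep n (insert x S)}" (is "_ = ?D")
  proof -
    have "?C = {card (orbit (Aut (lucas_cube n)) (edge_action (lucas_cube n)) (bits_edge n S x)) | S x.
        x \<notin> S \<and> cyc_indep n (insert x S)}"
      unfolding orbits_def edges_lucas_cube[OF assms] by blast
    also have "\<dots> = ?D"
      by (rule Collect_cong, (rule ex_cong1)+) (auto simp: card_orbit[OF assms])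
    finally show ?thesis .
  qed
  then have sub: "?C \<subseteq> {n, 2 * n}" by auto
  have "{n, 2 * n} \<subseteq> ?C" if n: "n \<ge> 5"
  proof -
    have "cyc_indep n {0}" using n by (intro cyc_indep_singleton) auto
    \<comment> \<open>With \<open>S\<close> empty only the position 0 is moved, and there the sign
      has no effect.\<close>
    moreover have "dih_pairs n {} 0 1 = dih_pairs n {} 0 (-1)"
      by (simp add: dih_pairs_def dih_def)
    ultimately have "n \<in> ?C" unfolding C by fastforce
    moreover have "cyc_indep n {0, 2}" using n by (auto simp: cyc_indep_def)
    then have "2 * n \<in> ?C" unfolding C using dih_pairs_neq[OF n] by fastforce
    ultimately show ?thesis by simp
  qed
  \<comment> \<open>Excluding \<open>2 * n\<close> also covers \<open>n = 1\<close>, where there are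
    no edges and \<open>?C\<close> is empty.\<close>
  moreover have "2 * n \<notin> ?C" if "\<not> n \<ge> 5"
    unfolding C using dih_pairs_eq_if_le_4[OF assms] that assms by auto
  ultimately show ?thesis using sub by blast
qed

end
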